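(* Let $\mathfrak{I}=(X,\mathcal{F},\Sigma)$ be an iterated function system over an arbitrary sub-shift $\Sigma$, where all maps in $\mathcal{F}=\{f_1,\dots,f_k\}$ are contractions. Let $A$ and $B$ be nonempty compact subsets of $X$. Then $\lim_{n\to\infty}H^n(A)$ exists in $(\mathcal{C},d_H)$, and $$\lim_{n\to\infty}H^n(A)=\lim_{n\to\infty}H^n(B).$$ Let $S=\lim_{n\to\infty}H^n(X)$. Then $S$ is unique (i.e. it is the common limit of $H^n(A)$ for all $A\in\mathcal{C}$), and $S\subseteq H^n(S)$ for every $n\in\mathbb{N}$.
   Context: $X$ is a nonempty compact metric space with metric $d$; $\mathcal{A}=\{1,\dots,k\}$, $k\ge 2$. $\Sigma$ is a nonempty sub-shift over $\mathcal{A}$: a closed subset of $\mathcal{A}^{\mathbb{N}}$ or $\mathcal{A}^{\mathbb{Z}}$ invariant under the shift map $(\tau\sigma)_i=\sigma_{i+1}$ ($\tau(\Sigma)\subseteq\Sigma$ in the one-sided case, $\tau(\Sigma)=\Sigma$ in the two-sided case). $\mathcal{L}_n(\Sigma)$ is the set of words of length $n$ occurring in points of $\Sigma$. Each $f_i:X\to X$ satisfies $d(f_i(x),f_i(y))\le r_i\,d(x,y)$ for all $x,y\in X$, with a constant $0\le r_i<1$. For a word $u=u_1\cdots u_n$, $f_u:=f_{u_n}\circ\cdots\circ f_{u_1}$. $\mathcal{C}$ is the set of nonempty compact subsets of $X$ with the Hausdorff metric $d_H$. For $n\in\mathbb{N}=\{1,2,\dots\}$ and $A\in\mathcal{C}$,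 $H^n(A):=\bigcup_{u\in\mathcal{L}_n(\Sigma)}f_u(A)$ (in general not the $n$-th iterate of $H^1$). *)

theory Defs
  imports "HOL-Analysis.Analysis"
begin

section \<open>Sub-shifts\<close>

definition shift :: "('i::semiring_1 \<Rightarrow> nat) \<Rightarrow> 'i \<Rightarrow> nat" where
  "shift \<sigma> = (\<lambda>i. \<sigma> (i + 1))"

text \<open>
  The alphabet is \<open>{1..k}\<close>, and \<open>'i\<close> is \<^typ>\<open>nat\<close> or \<^typ>\<open>int\<close>.
  One-sided sequences are indexed from \<open>0\<close>.
\<close>
definition full_shift :: "nat \<Rightarrow> ('i \<Rightarrow> nat) topology" where
  "full_shift k = product_topology (\<lambda>_. discrete_topology {1..k}) UNIV"

datatype shift_space =
    One_Sided "(nat \<Rightarrow> nat) set"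
  | Two_Sided "(int \<Rightarrow> nat) set"

fun subshift :: "nat \<Rightarrow> shift_space \<Rightarrow> bool" where
  "subshift k (One_Sided S) \<longleftrightarrow> S \<noteq> {} \<and> closedin (full_shift k) S \<and> shift ` S \<subseteq> S"
| "subshift k (Two_Sided S) \<longleftrightarrow> S \<noteq> {} \<and> closedin (full_shift k) S \<and> shift ` S = S"

definition words_of :: "nat \<Rightarrow> ('i::semiring_1 \<Rightarrow> nat) set \<Rightarrow> nat list set" where
  "words_of n S = {map (\<lambda>j. \<sigma> (i + of_nat j)) [0..<n] | \<sigma> i. \<sigma> \<in> S}"

fun language :: "nat \<Rightarrow> shift_space \<Rightarrow> nat list set" where
  "language n (One_Sided S) = words_of n S"
| "language n (Two_Sided S) = words_of n S"


section \<open>The maps \<open>H\<^sup>n\<close>\<close>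

text \<open>
  \<^term>\<open>fold f u\<close> applies \<open>f\<close> at the first letter of \<open>u\<close> first:
  for \<open>u = [u\<^sub>1, \<dots>, u\<^sub>n]\<close> it is \<open>f u\<^sub>n \<circ> \<dots> \<circ> f u\<^sub>1\<close>.
\<close>
definition ifs_H :: "(nat \<Rightarrow> 'a \<Rightarrow> 'a) \<Rightarrow> shift_space \<Rightarrow> nat \<Rightarrow> 'a set \<Rightarrow> 'a set" where
  "ifs_H f \<Sigma> n A = (\<Union>u \<in> language n \<Sigma>. fold f u ` A)"


section \<open>The Hausdorff metric\<close>

definition nonempty_compacts :: "'a::metric_space set \<Rightarrow> 'a set set" where
  "nonempty_compacts X = {A. A \<subseteq> X \<and> A \<noteq> {} \<and> compact A}"

text \<open>
  The suprema are meaningful for nonempty bounded sets only. The value \<open>0\<close> otherwise is a dummy: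
  \<^const>\<open>Metric_space\<close> demands nonnegativity also outside its carrier.
\<close>
definition hausdorff_dist :: "'a::metric_space set \<Rightarrow> 'a set \<Rightarrow> real" where
  "hausdorff_dist A B =
    (if A \<noteq> {} \<and> B \<noteq> {} \<and> bounded A \<and> bounded B
     then max (SUP a\<in>A. infdist a B) (SUP b\<in>B. infdist b A) else 0)"

definition hausdorff_topology :: "'a::metric_space set \<Rightarrow> 'a set topology" where
  "hausdorff_topology X = Metric_space.mtopology (nonempty_compacts X) hausdorff_dist"

lemma bdd_above_infdist:
  fixes A B :: "'a::metric_space set"
  assumes "bounded A" "B \<noteq> {}"
  shows "bdd_above ((\<lambda>a. infdist a B) ` A)"
proof -
  obtain b where b: "b \<in> B" using assms by blast
  obtain e where e: "\<And>a. a \<in> A \<Longrightarrow> dist b a \<le> e"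
    using assms(1) bounded_any_center[of A b] by auto
  have "infdist a B \<le> e" if "a \<in> A" for a
    using infdist_le[OF b, of a] e[OF that] by (simp add: dist_commute)
  then show ?thesis by (auto intro!: bdd_aboveI2)
qed

lemma hausdorff_dist_le_iff:
  fixes A B :: "'a::metric_space set"
  assumes "A \<noteq> {}" "B \<noteq> {}" "bounded A" "bounded B"
  shows "hausdorff_dist A B \<le> e \<longleftrightarrow>
    (\<forall>a\<in>A. infdist a B \<le> e) \<and> (\<forall>b\<in>B. infdist b A \<le> e)"
  using assms bdd_above_infdist[of A B] bdd_above_infdist[of B A]
  by (simp add: hausdorff_dist_def cSUP_le_iff)

lemma hausdorff_dist_commute: "hausdorff_dist A B = hausdorff_dist B A"
  by (auto simp: hausdorff_dist_def max.commute)

lemma hausdorff_dist_nonneg: "0 \<le> hausdorff_dist A B"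
proof (cases "A \<noteq> {} \<and> B \<noteq> {} \<and> bounded A \<and> bounded B")
  case True
  then obtain a where "a \<in> A" by blast
  moreover have "infdist a B \<le> hausdorff_dist A B"
    using hausdorff_dist_le_iff[of A B "hausdorff_dist A B"] True \<open>a \<in> A\<close> by auto
  ultimately show ?thesis using infdist_nonneg[of a B] by linarith
qed (auto simp: hausdorff_dist_def)

lemma Metric_space_hausdorff: "Metric_space (nonempty_compacts X) hausdorff_dist"
proof
  fix A B C :: "'a set"
  show "0 \<le> hausdorff_dist A B" by (rule hausdorff_dist_nonneg)
  show "hausdorff_dist A B = hausdorff_dist B A" by (rule hausdorff_dist_commute)
  assume "A \<in> nonempty_compacts X" "B \<in> nonempty_compacts X"
  then have AB: "A \<noteq> {}" "B \<noteq> {}" "bounded A" "bounded B" "closed A" "closed B"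
    by (auto simp: nonempty_compacts_def compact_imp_bounded compact_imp_closed)
  have zero: "infdist x Y \<le> 0 \<longleftrightarrow> x \<in> Y" if "closed Y" "Y \<noteq> {}" for x and Y :: "'a set"
    using in_closed_iff_infdist_zero[OF that, of x] infdist_nonneg[of x Y] by linarith
  have "hausdorff_dist A B \<le> 0 \<longleftrightarrow> (\<forall>a\<in>A. a \<in> B) \<and> (\<forall>b\<in>B. b \<in> A)"
    unfolding hausdorff_dist_le_iff[OF AB(1-4)] zero[OF AB(5,1)] zero[OF AB(6,2)] by (rule refl)
  then show "hausdorff_dist A B = 0 \<longleftrightarrow> A = B"
    using hausdorff_dist_nonneg[of A B] by auto
  assume "C \<in> nonempty_compacts X"
  then have C: "C \<noteq> {}" "bounded C"
    by (auto simp: nonempty_compacts_def compact_imp_bounded)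
  have *: "infdist p R \<le> hausdorff_dist P Q + hausdorff_dist Q R"
    if ne: "P \<noteq> {}" "Q \<noteq> {}" "R \<noteq> {}" and bd: "bounded P" "bounded Q" "bounded R" and p: "p \<in> P"
    for P Q R :: "'a set" and p
  proof -
    have "infdist p R - hausdorff_dist Q R \<le> dist p q" if "q \<in> Q" for q
      using hausdorff_dist_le_iff[of Q R "hausdorff_dist Q R"] ne bd that
        infdist_triangle[of p R q] by fastforce
    then have "infdist p R - hausdorff_dist Q R \<le> infdist p Q"
      using ne by (auto simp: infdist_def intro!: cINF_greatest)
    moreover have "infdist p Q \<le> hausdorff_dist P Q"
      using hausdorff_dist_le_iff[of P Q "hausdorff_dist P Q"] ne bd p by auto
    ultimately show ?thesis by linarith
  qed
  have "infdist a C \<le> hausdorff_dist A B + hausdorff_dist B C" if "a \<in> A" for a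
    using *[of A B C a] AB C that by blast
  moreover have "infdist c A \<le> hausdorff_dist A B + hausdorff_dist B C" if "c \<in> C" for c
    using *[of C B A c] AB C that hausdorff_dist_commute[of A B] hausdorff_dist_commute[of B C]
    by (metis add.commute)
  ultimately show "hausdorff_dist A C \<le> hausdorff_dist A B + hausdorff_dist B C"
    using hausdorff_dist_le_iff[of A C] AB C by blast
qed

end

theory Submission
  imports Defs
begin

text \<open>
  Let \<open>\<rho> < 1\<close> bound all the ratios \<open>r\<^sub>i\<close>. Every \<open>f\<^sub>u\<close> with \<open>u\<close> of length \<open>n\<close> contracts by
  \<open>\<rho>\<^sup>n\<close>, so \<open>H\<^sup>n\<close> contracts the Hausdorff distance by \<open>\<rho>\<^sup>n\<close>
  (\<open>hausdorff_dist_ifs_H_le\<close>). Hence all the sequences \<open>H\<^sup>n(A)\<close> are asymptotic to each other,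
  and it suffices to understand \<open>H\<^sup>n(X)\<close>.

  The operators \<open>H\<^sup>n\<close> need not form a semigroup, since two words of the language cannot always be
  concatenated. The language is closed under subwords, however, and cutting a word of length
  \<open>m + n\<close> after its first \<open>m\<close> letters still gives the inclusion
  \<open>H\<^sup>m\<^sup>+\<^sup>n(A) \<subseteq> H\<^sup>n(H\<^sup>m(A))\<close> (\<open>ifs_H_add_subset\<close>). It is used twice:
  as \<open>H\<^sup>m(X) \<subseteq> X\<close>, it shows that the compact sets \<open>H\<^sup>n(X)\<close> decrease, so they converge to
  their intersection \<open>S\<close>; and letting \<open>m\<close> tend to infinity in it, with \<open>H\<^sup>n\<close> continuous, gives
  \<open>S \<subseteq> H\<^sup>n(S)\<close> (\<open>attractor_subset_H\<close>).
\<close>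

section \<open>Words of a sub-shift\<close>

lemma words_of_ne: "S \<noteq> {} \<Longrightarrow> words_of n S \<noteq> {}"
  by (auto simp: words_of_def)

lemma length_words_of: "u \<in> words_of n S \<Longrightarrow> length u = n"
  by (auto simp: words_of_def)

lemma set_words_of:
  assumes "closedin (full_shift k) S" "u \<in> words_of n S"
  shows "set u \<subseteq> {1..k}"
proof -
  have "\<sigma> i \<in> {1..k}" if "\<sigma> \<in> S" for \<sigma> i
    using closedin_subset[OF assms(1)] that
    by (auto simp: full_shift_def PiE_def Pi_def)
  then show ?thesis
    using assms(2) by (fastforce simp: words_of_def)
qed

lemma take_words_of:
  assumes "u \<in> words_of (m + n) S"
  shows "take m u \<in> words_of m S"
proof -
  obtain \<sigma> i where u: "\<sigma> \<in> S" "u = map (\<lambda>j. \<sigma> (i + of_nat j)) [0..<m + n]"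
    using assms by (auto simp: words_of_def)
  have "take m u = map (\<lambda>j. \<sigma> (i + of_nat j)) [0..<m]"
    by (rule nth_equalityI) (auto simp: u)
  then show ?thesis
    using u(1) unfolding words_of_def by blast
qed

text \<open>
  The position at which a word is read is arbitrary in the definition of the words of a sub-shift,
  so a suffix is read from the same sequence at a later position, without shifting the sequence.
\<close>

lemma drop_words_of:
  assumes "u \<in> words_of (m + n) S"
  shows "drop m u \<in> words_of n S"
proof -
  obtain \<sigma> i where u: "\<sigma> \<in> S" "u = map (\<lambda>j. \<sigma> (i + of_nat j)) [0..<m + n]"
    using assms by (auto simp: words_of_def)
  have "drop m u = map (\<lambda>j. \<sigma> ((i + of_nat m) + of_nat j)) [0..<n]"
    by (rule nth_equalityI) (auto simp: u ac_simps)
  then show ?thesis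
    using u(1) unfolding words_of_def by blast
qed

lemma language_ne: "subshift k \<Sigma> \<Longrightarrow> language n \<Sigma> \<noteq> {}"
  by (cases \<Sigma>) (simp_all add: words_of_ne)

lemma length_language: "u \<in> language n \<Sigma> \<Longrightarrow> length u = n"
  by (cases \<Sigma>) (auto dest: length_words_of)

lemma set_language: "subshift k \<Sigma> \<Longrightarrow> u \<in> language n \<Sigma> \<Longrightarrow> set u \<subseteq> {1..k}"
  by (cases \<Sigma>) (auto dest!: set_words_of)

lemma finite_language:
  assumes "subshift k \<Sigma>"
  shows "finite (language n \<Sigma>)"
proof (rule finite_subset)
  show "language n \<Sigma> \<subseteq> {u. set u \<subseteq> {1..k} \<and> length u = n}"
    using set_language[OF assms] length_language by blast
  show "finite {u. set u \<subseteq> {1..k} \<and> length u = n}"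
    by (rule finite_lists_length_eq) simp
qed

lemma take_language: "u \<in> language (m + n) \<Sigma> \<Longrightarrow> take m u \<in> language m \<Sigma>"
  by (cases \<Sigma>) (simp_all add: take_words_of)

lemma drop_language: "u \<in> language (m + n) \<Sigma> \<Longrightarrow> drop m u \<in> language n \<Sigma>"
  by (cases \<Sigma>) (simp_all add: drop_words_of)

lemma ifs_H_mono: "A \<subseteq> B \<Longrightarrow> ifs_H f \<Sigma> n A \<subseteq> ifs_H f \<Sigma> n B"
  by (auto simp: ifs_H_def)

text \<open>
  The inclusion can be strict: on the right, any word of length \<open>m\<close> may be followed by any
  word of length \<open>n\<close>, whether or not the concatenation occurs in the sub-shift.
\<close>

lemma ifs_H_add_subset: "ifs_H f \<Sigma> (m + n) A \<subseteq> ifs_H f \<Sigma> n (ifs_H f \<Sigma> m A)"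
proof
  fix x assume "x \<in> ifs_H f \<Sigma> (m + n) A"
  then obtain u a where u: "u \<in> language (m + n) \<Sigma>" "a \<in> A" "x = fold f u a"
    by (auto simp: ifs_H_def)
  have "x = fold f (drop m u) (fold f (take m u) a)"
    using u(3) by (metis append_take_drop_id comp_apply fold_append)
  then show "x \<in> ifs_H f \<Sigma> n (ifs_H f \<Sigma> m A)"
    using take_language[OF u(1)] drop_language[OF u(1)] u(2) by (auto simp: ifs_H_def)
qed


section \<open>Decreasing sequences of compact sets\<close>

lemma decseq_compact_INT_ne:
  fixes K :: "nat \<Rightarrow> 'a::t2_space set"
  assumes "\<And>n. compact (K n)" "\<And>n. K n \<noteq> {}" "decseq K"
  shows "(\<Inter>n. K n) \<noteq> {}"
proof -
  have "K 0 \<inter> \<Inter>(range K) \<noteq> {}"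
  proof (rule compact_imp_fip[OF assms(1)])
    show "closed T" if "T \<in> range K" for T
      using that assms(1) compact_imp_closed by blast
    fix F assume "finite F" "F \<subseteq> range K"
    then obtain I where I: "finite I" "F = K ` I"
      by (metis finite_subset_image)
    define N where "N = Max (insert 0 I)"
    have "K N \<subseteq> K i" if "i \<in> insert 0 I" for i
      using that I(1) by (intro decseqD[OF assms(3)]) (auto simp: N_def)
    then have "K N \<subseteq> K 0 \<inter> \<Inter>F"
      using I(2) by auto
    then show "K 0 \<inter> \<Inter>F \<noteq> {}"
      using assms(2)[of N] by blast
  qed
  then show ?thesis by blast
qed

text \<open>
  Otherwise the parts of the sets at distance at least \<open>e\<close> from the intersection would be nonempty
  compact sets that decrease, and a point common to them would belong to the intersection.
\<close>

lemma decseq_compact_close_to_INT: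
  fixes K :: "nat \<Rightarrow> 'a::metric_space set"
  assumes "\<And>n. compact (K n)" "\<And>n. K n \<noteq> {}" "decseq K" "0 < e"
  shows "\<forall>\<^sub>F n in sequentially. \<forall>x\<in>K n. infdist x (\<Inter>n. K n) < e"
proof -
  define T where "T n = K n \<inter> {x. e \<le> infdist x (\<Inter>n. K n)}" for n
  have "closed {x. e \<le> infdist x (\<Inter>n. K n)}"
    by (intro closed_Collect_le continuous_intros)
  then have "compact (T n)" for n
    using assms(1) unfolding T_def by (rule compact_Int_closed[rotated])
  moreover have T: "decseq T"
    using assms(3) unfolding T_def decseq_def by (intro allI impI Int_mono) auto
  moreover have "(\<Inter>n. T n) = {}"
  proof (rule equals0I)
    fix x assume "x \<in> (\<Inter>n. T n)"
    then have "x \<in> (\<Inter>n. K n)" "e \<le> infdist x (\<Inter>n. K n)"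
      by (auto simp: T_def)
    then show False
      using assms(4) by simp
  qed
  ultimately obtain N where "T N = {}"
    using decseq_compact_INT_ne[of T] by blast
  then have "T n = {}" if "N \<le> n" for n
    using decseqD[OF T that] by blast
  then show ?thesis
    unfolding eventually_sequentially T_def by (fastforce simp: not_le)
qed

lemma limitin_hausdorff_topology:
  "limitin (hausdorff_topology X) K L sequentially \<longleftrightarrow>
    L \<in> nonempty_compacts X \<and>
    (\<forall>e>0. \<forall>\<^sub>F n in sequentially. K n \<in> nonempty_compacts X \<and> hausdorff_dist (K n) L < e)"
  unfolding hausdorff_topology_def
  by (rule Metric_space.limitin_metric[OF Metric_space_hausdorff])

lemma limitin_hausdorff_unique:
  assumes "limitin (hausdorff_topology X) K L sequentially"
    "limitin (hausdorff_topology X) K L' sequentially"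
  shows "L = L'"
  using assms unfolding hausdorff_topology_def
  by (metis Metric_space.limitin_metric_unique Metric_space_hausdorff trivial_limit_sequentially)

lemma limitin_hausdorff_decseq:
  fixes K :: "nat \<Rightarrow> 'a::metric_space set"
  assumes K: "\<And>n. K n \<in> nonempty_compacts X" and "decseq K"
  shows "limitin (hausdorff_topology X) K (\<Inter>n. K n) sequentially"
proof -
  have c: "compact (K n)" "K n \<noteq> {}" "bounded (K n)" for n
    using K[of n] by (auto simp: nonempty_compacts_def compact_imp_bounded)
  let ?S = "\<Inter>n. K n"
  have "closed ?S"
    using c(1) compact_imp_closed by blast
  then have "compact (K 0 \<inter> ?S)"
    using c(1) by blast
  moreover have "K 0 \<inter> ?S = ?S" by blast
  ultimately have "compact ?S" by simp
  moreover have ne: "?S \<noteq> {}"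
    using decseq_compact_INT_ne c(1,2) \<open>decseq K\<close> .
  moreover have "?S \<subseteq> X"
    using K by (auto simp: nonempty_compacts_def)
  ultimately have S: "?S \<in> nonempty_compacts X" "bounded ?S"
    by (auto simp: nonempty_compacts_def compact_imp_bounded)
  have "\<forall>\<^sub>F n in sequentially. hausdorff_dist (K n) ?S < e" if "0 < e" for e
  proof -
    have "\<forall>\<^sub>F n in sequentially. \<forall>x\<in>K n. infdist x ?S < e / 2"
      by (rule decseq_compact_close_to_INT) (use c \<open>decseq K\<close> that in auto)
    then show ?thesis
    proof eventually_elim
      case (elim n)
      have "hausdorff_dist (K n) ?S \<le> e / 2"
        unfolding hausdorff_dist_le_iff[OF c(2) ne c(3) S(2)]
        using elim that by (auto intro: less_imp_le)
      then show ?case using that by simp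
    qed
  qed
  then show ?thesis
    using S(1) K by (simp add: limitin_hausdorff_topology)
qed


section \<open>Contractions indexed by a sub-shift\<close>

locale contractive_subshift_ifs =
  fixes X :: "'a::metric_space set" and k :: nat and f :: "nat \<Rightarrow> 'a \<Rightarrow> 'a"
    and \<rho> :: real and \<Sigma> :: shift_space
  assumes X: "compact X" "X \<noteq> {}"
    and subshift: "subshift k \<Sigma>"
    and maps: "\<And>i. i \<in> {1..k} \<Longrightarrow> f i \<in> X \<rightarrow> X"
    and ratio: "0 \<le> \<rho>" "\<rho> < 1"
    and contraction:
      "\<And>i x y. i \<in> {1..k} \<Longrightarrow> x \<in> X \<Longrightarrow> y \<in> X \<Longrightarrow> dist (f i x) (f i y) \<le> \<rho> * dist x y"
begin

abbreviation H :: "nat \<Rightarrow> 'a set \<Rightarrow> 'a set" where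
  "H \<equiv> ifs_H f \<Sigma>"

lemma fold_in_X: "set u \<subseteq> {1..k} \<Longrightarrow> x \<in> X \<Longrightarrow> fold f u x \<in> X"
proof (induction u arbitrary: x)
  case (Cons i u)
  then have "f i x \<in> X"
    using maps[of i] by auto
  then show ?case using Cons by simp
qed simp

lemma dist_fold_le:
  "set u \<subseteq> {1..k} \<Longrightarrow> x \<in> X \<Longrightarrow> y \<in> X \<Longrightarrow>
    dist (fold f u x) (fold f u y) \<le> \<rho> ^ length u * dist x y"
proof (induction u arbitrary: x y)
  case (Cons i u)
  then have i: "i \<in> {1..k}" and fX: "f i x \<in> X" "f i y \<in> X"
    using maps[of i] by auto
  have "dist (fold f u (f i x)) (fold f u (f i y)) \<le> \<rho> ^ length u * dist (f i x) (f i y)"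
    using Cons.IH[OF _ fX] Cons.prems(1) by simp
  also have "\<dots> \<le> \<rho> ^ length u * (\<rho> * dist x y)"
    using contraction[OF i] Cons.prems ratio by (intro mult_left_mono) auto
  finally show ?case by (simp add: mult.commute mult.left_commute)
qed simp

lemma H_nonempty_compacts:
  assumes "A \<in> nonempty_compacts X"
  shows "H n A \<in> nonempty_compacts X"
proof -
  have A: "A \<subseteq> X" "A \<noteq> {}" "compact A"
    using assms by (auto simp: nonempty_compacts_def)
  have "compact (fold f u ` A)" if u: "u \<in> language n \<Sigma>" for u
  proof (rule compact_continuous_image[OF _ A(3)])
    have "(\<rho> ^ length u)-lipschitz_on A (fold f u)"
      using set_language[OF subshift u] A(1) ratio
      by (intro lipschitz_onI dist_fold_le) auto
    then show "continuous_on A (fold f u)"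
      by (rule lipschitz_on_continuous_on)
  qed
  then have "compact (H n A)"
    unfolding ifs_H_def by (intro compact_UN finite_language[OF subshift])
  moreover have "H n A \<noteq> {}"
    using language_ne[OF subshift] A(2) by (auto simp: ifs_H_def)
  moreover have "H n A \<subseteq> X"
    using fold_in_X[OF set_language[OF subshift]] A(1) by (auto simp: ifs_H_def)
  ultimately show ?thesis
    by (simp add: nonempty_compacts_def)
qed

lemma infdist_H_le:
  assumes "A \<subseteq> X" "B \<in> nonempty_compacts X"
    and close: "\<And>a. a \<in> A \<Longrightarrow> infdist a B \<le> e" and "x \<in> H n A"
  shows "infdist x (H n B) \<le> \<rho> ^ n * e"
proof -
  have B: "B \<subseteq> X" "B \<noteq> {}" "compact B"
    using assms(2) by (auto simp: nonempty_compacts_def)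
  obtain u a where u: "u \<in> language n \<Sigma>" and a: "a \<in> A" and x: "x = fold f u a"
    using assms(4) by (auto simp: ifs_H_def)
  have "continuous_on B (dist a)"
    by (intro continuous_intros)
  then obtain b where b: "b \<in> B" "\<And>y. y \<in> B \<Longrightarrow> dist a b \<le> dist a y"
    using continuous_attains_inf[OF B(3,2)] by blast
  then have "dist a b \<le> infdist a B"
    using B(2) by (auto simp: infdist_notempty intro!: cINF_greatest)
  have "infdist x (H n B) \<le> dist x (fold f u b)"
    using u b(1) by (intro infdist_le) (auto simp: ifs_H_def)
  also have "\<dots> \<le> \<rho> ^ n * dist a b"
    using dist_fold_le[OF set_language[OF subshift u], of a b] length_language[OF u]
      a b(1) B(1) assms(1) x by auto
  also have "\<dots> \<le> \<rho> ^ n * e"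
    using close[OF a] \<open>dist a b \<le> infdist a B\<close> ratio by (intro mult_left_mono) auto
  finally show ?thesis .
qed

lemma hausdorff_dist_ifs_H_le:
  assumes A: "A \<in> nonempty_compacts X" and B: "B \<in> nonempty_compacts X"
  shows "hausdorff_dist (H n A) (H n B) \<le> \<rho> ^ n * hausdorff_dist A B"
proof -
  have ne_bdd: "C \<noteq> {}" "bounded C" "C \<subseteq> X" if "C \<in> nonempty_compacts X" for C
    using that by (auto simp: nonempty_compacts_def compact_imp_bounded)
  note HA = H_nonempty_compacts[OF A, of n] and HB = H_nonempty_compacts[OF B, of n]
  have close: "\<forall>a\<in>A. infdist a B \<le> hausdorff_dist A B"
      "\<forall>b\<in>B. infdist b A \<le> hausdorff_dist A B"
    using hausdorff_dist_le_iff[of A B "hausdorff_dist A B"] ne_bdd[OF A] ne_bdd[OF B]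
    by simp_all
  have "\<forall>x\<in>H n A. infdist x (H n B) \<le> \<rho> ^ n * hausdorff_dist A B"
    using infdist_H_le[OF ne_bdd(3)[OF A] B] close(1) by simp
  moreover have "\<forall>x\<in>H n B. infdist x (H n A) \<le> \<rho> ^ n * hausdorff_dist A B"
    using infdist_H_le[OF ne_bdd(3)[OF B] A] close(2) by simp
  ultimately show ?thesis
    using hausdorff_dist_le_iff[OF ne_bdd(1)[OF HA] ne_bdd(1)[OF HB]
        ne_bdd(2)[OF HA] ne_bdd(2)[OF HB]] by simp
qed

lemma X_nonempty_compacts: "X \<in> nonempty_compacts X"
  using X by (simp add: nonempty_compacts_def)

text \<open>
  A word acts through its last letter outermost, so dropping the first letter of a word
  \<open>u\<close> enlarges \<open>f\<^sub>u(X)\<close>.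
\<close>

lemma decseq_H_X: "decseq (\<lambda>n. H n X)"
proof (rule decseq_SucI)
  fix n
  have "H (1 + n) X \<subseteq> H n (H 1 X)"
    by (rule ifs_H_add_subset)
  also have "\<dots> \<subseteq> H n X"
    using H_nonempty_compacts[OF X_nonempty_compacts]
    by (intro ifs_H_mono) (auto simp: nonempty_compacts_def)
  finally show "H (Suc n) X \<subseteq> H n X" by simp
qed

definition attractor :: "'a set" where
  "attractor = (\<Inter>n. H n X)"

lemma limitin_H_X: "limitin (hausdorff_topology X) (\<lambda>n. H n X) attractor sequentially"
  unfolding attractor_def
  by (rule limitin_hausdorff_decseq[OF H_nonempty_compacts[OF X_nonempty_compacts] decseq_H_X])

lemma attractor_nonempty_compacts: "attractor \<in> nonempty_compacts X"
  using limitin_H_X by (simp add: limitin_hausdorff_topology)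

lemma limitin_H:
  assumes A: "A \<in> nonempty_compacts X"
  shows "limitin (hausdorff_topology X) (\<lambda>n. H n A) attractor sequentially"
proof -
  have "\<forall>\<^sub>F n in sequentially. hausdorff_dist (H n A) attractor < e" if "0 < e" for e
  proof -
    have "(\<lambda>n. \<rho> ^ n * hausdorff_dist A X) \<longlonglongrightarrow> 0 * hausdorff_dist A X"
      using ratio by (intro tendsto_mult_right LIMSEQ_power_zero) auto
    then have "\<forall>\<^sub>F n in sequentially. \<rho> ^ n * hausdorff_dist A X < e / 2"
      using that by (intro order_tendstoD(2)) auto
    moreover have "\<forall>\<^sub>F n in sequentially. hausdorff_dist (H n X) attractor < e / 2"
      using limitin_H_X half_gt_zero[OF that]
      unfolding limitin_hausdorff_topology eventually_conj_iff by blast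
    ultimately show ?thesis
    proof eventually_elim
      case (elim n)
      have "hausdorff_dist (H n A) attractor
          \<le> hausdorff_dist (H n A) (H n X) + hausdorff_dist (H n X) attractor"
        by (intro Metric_space.triangle[OF Metric_space_hausdorff[of X]] H_nonempty_compacts
            A X_nonempty_compacts attractor_nonempty_compacts)
      then show ?case
        using hausdorff_dist_ifs_H_le[OF A X_nonempty_compacts, of n] elim by linarith
    qed
  qed
  then show ?thesis
    using A attractor_nonempty_compacts
    by (simp add: limitin_hausdorff_topology H_nonempty_compacts)
qed

text \<open>
  A point of the attractor lies in \<open>H\<^sup>m\<^sup>+\<^sup>n(X) \<subseteq> H\<^sup>n(H\<^sup>m(X))\<close> for every \<open>m\<close>, and
  \<open>H\<^sup>n(H\<^sup>m(X))\<close> is at least as close to \<open>H\<^sup>n(attractor)\<close> as \<open>H\<^sup>m(X)\<close> is to the attractor.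
  As \<open>H\<^sup>n(attractor)\<close> is closed, it contains the point.
\<close>

lemma attractor_subset_H: "attractor \<subseteq> H n attractor"
proof
  fix x assume x: "x \<in> attractor"
  have S: "H n attractor \<noteq> {}" "closed (H n attractor)"
    using H_nonempty_compacts[OF attractor_nonempty_compacts, of n]
    by (auto simp: nonempty_compacts_def compact_imp_closed)
  have HX: "compact (H m X)" "H m X \<noteq> {}" "H m X \<subseteq> X" for m
    using H_nonempty_compacts[OF X_nonempty_compacts, of m]
    by (auto simp: nonempty_compacts_def)
  have "infdist x (H n attractor) \<le> 0 + e" if "0 < e" for e
  proof -
    have "\<forall>\<^sub>F m in sequentially. \<forall>y\<in>H m X. infdist y attractor < e"
      unfolding attractor_def by (rule decseq_compact_close_to_INT[OF HX(1,2) decseq_H_X that])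
    then obtain m where m: "\<forall>y\<in>H m X. infdist y attractor < e"
      by (auto simp: eventually_sequentially)
    have "x \<in> H (m + n) X"
      using x unfolding attractor_def by (rule INT_D) simp
    then have xm: "x \<in> H n (H m X)"
      using ifs_H_add_subset by (rule rev_subsetD)
    have "infdist x (H n attractor) \<le> \<rho> ^ n * e"
      by (rule infdist_H_le[OF HX(3) attractor_nonempty_compacts _ xm])
        (use m in \<open>auto intro: less_imp_le\<close>)
    also have "\<dots> \<le> e"
      using ratio that by (simp add: mult_left_le_one_le power_le_one)
    finally show ?thesis by simp
  qed
  then have "infdist x (H n attractor) \<le> 0"
    by (rule field_le_epsilon)
  then have "infdist x (H n attractor) = 0"
    using infdist_nonneg[of x "H n attractor"] by linarith
  then show "x \<in> H n attractor"
    using in_closed_iff_infdist_zero[OF S(2,1)] by simp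
qed

end


section \<open>The limit of the sets \<open>H\<^sup>n(A)\<close>\<close>

theorem proposition3p9:
  fixes X :: "'a::metric_space set"
    and k :: nat
    and f :: "nat \<Rightarrow> 'a \<Rightarrow> 'a"
    and r :: "nat \<Rightarrow> real"
    and \<Sigma> :: shift_space
    and A B :: "'a set"
  assumes "compact X" and "X \<noteq> {}"
    and "2 \<le> k"
    and "subshift k \<Sigma>"
    and "\<And>i. i \<in> {1..k} \<Longrightarrow> f i \<in> X \<rightarrow> X"
    and "\<And>i. i \<in> {1..k} \<Longrightarrow> 0 \<le> r i \<and> r i < 1"
    and "\<And>i x y. i \<in> {1..k} \<Longrightarrow> x \<in> X \<Longrightarrow> y \<in> X \<Longrightarrow> dist (f i x) (f i y) \<le> r i * dist x y"
    and "A \<in> nonempty_compacts X" and "B \<in> nonempty_compacts X"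
  shows "(\<exists>!L. limitin (hausdorff_topology X) (\<lambda>n. ifs_H f \<Sigma> n A) L sequentially)
    \<and> (\<forall>L. limitin (hausdorff_topology X) (\<lambda>n. ifs_H f \<Sigma> n A) L sequentially
         \<longleftrightarrow> limitin (hausdorff_topology X) (\<lambda>n. ifs_H f \<Sigma> n B) L sequentially)
    \<and> (\<exists>S. limitin (hausdorff_topology X) (\<lambda>n. ifs_H f \<Sigma> n X) S sequentially
         \<and> (\<forall>C \<in> nonempty_compacts X. \<forall>L.
              limitin (hausdorff_topology X) (\<lambda>n. ifs_H f \<Sigma> n C) L sequentially \<longleftrightarrow> L = S)
         \<and> (\<forall>n\<ge>1. S \<subseteq> ifs_H f \<Sigma> n S))"
proof -
  define \<rho> where "\<rho> = Max (r ` {1..k})"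
  have ne: "{1..k} \<noteq> {}"
    using assms(3) by simp
  then have "\<rho> \<in> r ` {1..k}"
    unfolding \<rho>_def by (intro Max_in) auto
  then have \<rho>: "0 \<le> \<rho>" "\<rho> < 1"
    using assms(6) by auto
  have r_le: "r i \<le> \<rho>" if "i \<in> {1..k}" for i
    using that by (simp add: \<rho>_def)
  interpret contractive_subshift_ifs X k f \<rho> \<Sigma>
  proof
    show "dist (f i x) (f i y) \<le> \<rho> * dist x y" if "i \<in> {1..k}" "x \<in> X" "y \<in> X" for i x y
      using assms(7)[OF that] mult_right_mono[OF r_le[OF that(1)] zero_le_dist[of x y]]
      by linarith
  qed (use assms \<rho> in auto)
  have lim: "limitin (hausdorff_topology X) (\<lambda>n. H n C) L sequentially \<longleftrightarrow> L = attractor"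
    if "C \<in> nonempty_compacts X" for C L
    using limitin_H[OF that] limitin_hausdorff_unique by blast
  show ?thesis
  proof (intro conjI exI[of _ attractor] ballI allI impI)
    show "\<exists>!L. limitin (hausdorff_topology X) (\<lambda>n. H n A) L sequentially"
      by (simp add: lim[OF assms(8)])
    show "limitin (hausdorff_topology X) (\<lambda>n. H n A) L sequentially
        \<longleftrightarrow> limitin (hausdorff_topology X) (\<lambda>n. H n B) L sequentially" for L
      by (simp add: lim[OF assms(8)] lim[OF assms(9)])
  qed (rule limitin_H_X lim attractor_subset_H; assumption?)+
qed

end
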